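(* Let $\mathfrak a\in C([-1,1]\times\mathbb R_+)$ satisfy $$\mathfrak a(s,v)+\mathfrak a(t,v)\ge\mathfrak a\Big(\frac{s-t}2,v\Big)+\mathfrak a\Big(\frac{t-s}2,v\Big)\qquad\text{for all } s,t\in[-1,1],\ v\in\mathbb R_+ .$$ Then $\mathfrak a$ is even and convex with respect to the first argument.
   Context: $\mathbb R_+=[0,\infty)$; $C([-1,1]\times\mathbb R_+)$ denotes the continuous real-valued functions on $[-1,1]\times\mathbb R_+$. *)

theory Defs
  imports "HOL-Analysis.Analysis"
begin

end

theory Submission
  imports Defs
begin

text \<open>
  Fix \<open>v\<close>, write \<open>f = a(\<cdot>, v)\<close> and split \<open>f = h + g\<close> into its even part \<open>h\<close> and its odd part \<open>g\<close>.
  Replacing \<open>t\<close> by \<open>- t\<close> in the hypothesis, and then exchanging \<open>s\<close> and \<open>t\<close>, gives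
  \<open>\<bar>g s - g t\<bar> \<le> h s + h t - 2 * h ((s + t) / 2)\<close>.

  In particular \<open>h\<close> is midpoint convex. The point is that the inequality also forces \<open>g\<close> to be
  constant (\<open>second_difference_bound_imp_constant\<close>): it bounds increments of \<open>g\<close> by second
  differences of \<open>h\<close>. Along an equidistant grid the bound for the total increment telescopes,
  because the first differences of \<open>h\<close> increase, to a difference of two first differences of
  \<open>h\<close> at the ends of the interval. Those vanish with the mesh size, by continuity of \<open>h\<close>.
  An odd constant function is \<open>0\<close>, so \<open>f = h\<close> is even and midpoint convex, and a continuous
  midpoint convex function is convex (\<open>continuous_midpoint_convex_imp_convex_on\<close>).
\<close>

text \<open>
  A positive maximum would be attained at a leftmost point \<open>c\<close>, which lies inside the interval;
  at \<open>c\<close> midpoint convexity fails on the largest symmetric interval around \<open>c\<close>, since the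
  maximum is not attained to the left of \<open>c\<close>.
\<close>
lemma midpoint_convex_zero_ends_imp_nonpos:
  fixes \<phi> :: "real \<Rightarrow> real"
  assumes cont: "continuous_on {0..1} \<phi>"
    and ends: "\<phi> 0 = 0" "\<phi> 1 = 0"
    and mid: "\<And>s t. s \<in> {0..1} \<Longrightarrow> t \<in> {0..1} \<Longrightarrow> 2 * \<phi> ((s + t) / 2) \<le> \<phi> s + \<phi> t"
    and u: "u \<in> {0..1}"
  shows "\<phi> u \<le> 0"
proof (rule ccontr)
  assume pos: "\<not> \<phi> u \<le> 0"
  obtain m where m: "m \<in> {0..1}" "\<forall>t\<in>{0..1}. \<phi> t \<le> \<phi> m"
    using continuous_attains_sup[OF compact_Icc _ cont] u by blast
  let ?K = "{t \<in> {0..1}. \<phi> t = \<phi> m}"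
  have "closed ?K"
    using continuous_closed_preimage_constant[OF cont] by simp
  moreover have "bounded ?K"
    by (rule bounded_subset[OF bounded_closed_interval[of 0 1]]) auto
  ultimately have "compact ?K"
    using compact_eq_bounded_closed by blast
  then obtain c where c: "c \<in> ?K" "\<forall>t\<in>?K. c \<le> t"
    using compact_attains_inf[of ?K] m(1) by auto
  have "\<phi> c > 0"
    using pos m u c by force
  then have c01: "0 < c" "c < 1"
    using c(1) ends by (auto simp: less_le)
  define d where "d = min c (1 - c)"
  have d: "0 < d" "c - d \<in> {0..1}" "c + d \<in> {0..1}"
    using c01 by (auto simp: d_def)
  have "\<phi> (c - d) < \<phi> m"
    using c(2) d m(2) by (metis (mono_tags, lifting) diff_less_eq le_less less_add_same_cancel1 mem_Collect_eq not_le)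
  moreover have "\<phi> (c + d) \<le> \<phi> m"
    using m d by blast
  moreover have "2 * \<phi> c \<le> \<phi> (c - d) + \<phi> (c + d)"
    using mid[OF d(2,3)] by simp
  ultimately show False
    using c(1) by simp
qed

text \<open>Subtracting the chord reduces convexity along a segment to the previous lemma.\<close>
lemma continuous_midpoint_convex_imp_convex_on:
  fixes f :: "'a::real_normed_vector \<Rightarrow> real"
  assumes S: "convex S" and cont: "continuous_on S f"
    and mid: "\<And>x y. x \<in> S \<Longrightarrow> y \<in> S \<Longrightarrow> 2 * f (midpoint x y) \<le> f x + f y"
  shows "convex_on S f"
proof (rule convex_onI[OF _ S])
  fix u :: real and x y
  assume u: "0 < u" "u < 1" and xy: "x \<in> S" "y \<in> S"
  define p where "p = (\<lambda>t. (1 - t) *\<^sub>R x + t *\<^sub>R y)"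
  have pS: "p t \<in> S" if "t \<in> {0..1}" for t
    using convexD_alt[OF S xy] that by (auto simp: p_def)
  define \<phi> where "\<phi> = (\<lambda>t. f (p t) - ((1 - t) * f x + t * f y))"
  have "\<phi> u \<le> 0"
  proof (rule midpoint_convex_zero_ends_imp_nonpos[where \<phi> = \<phi>])
    have "continuous_on {0..1} p"
      unfolding p_def by (intro continuous_intros)
    then have "continuous_on {0..1} (\<lambda>t. f (p t))"
      using pS by (intro continuous_on_compose2[OF cont]) auto
    then show "continuous_on {0..1} \<phi>"
      unfolding \<phi>_def by (intro continuous_intros)
  next
    fix s t :: real
    assume "s \<in> {0..1}" "t \<in> {0..1}"
    then have "2 * f (midpoint (p s) (p t)) \<le> f (p s) + f (p t)"
      using mid pS by blast
    moreover have "midpoint (p s) (p t) = p ((s + t) / 2)"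
      by (simp add: midpoint_def p_def algebra_simps add_divide_distrib
          scaleR_left_distrib[of "1 / 2" "1 / 2" x, symmetric])
    ultimately show "2 * \<phi> ((s + t) / 2) \<le> \<phi> s + \<phi> t"
      by (simp add: \<phi>_def field_simps)
  qed (use u in \<open>auto simp: \<phi>_def p_def\<close>)
  then show "f ((1 - u) *\<^sub>R x + u *\<^sub>R y) \<le> (1 - u) * f x + u * f y"
    by (simp add: \<phi>_def p_def)
qed

text \<open>
  The grid has mesh \<open>2 * d\<close>, so that the cell midpoints occurring in the hypothesis are the odd
  multiples of \<open>d\<close>, and consecutive first differences of \<open>h\<close> with step \<open>d\<close> can be compared.
\<close>
lemma second_difference_bound_imp_constant:
  fixes g h :: "real \<Rightarrow> real"
  assumes ab: "a \<le> b" and cont: "continuous_on {a..b} h"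
    and bound: "\<And>s t. s \<in> {a..b} \<Longrightarrow> t \<in> {a..b} \<Longrightarrow>
      \<bar>g s - g t\<bar> \<le> h s + h t - 2 * h ((s + t) / 2)"
  shows "g a = g b"
proof -
  define d where "d = (\<lambda>n. (b - a) / (2 * real (Suc n)))"
  have d_total: "a + real (2 * Suc n) * d n = b" for n
    by (simp add: d_def field_simps)
  have d_nonneg: "0 \<le> d n" for n
    using ab by (simp add: d_def)
  have grid_bound: "\<bar>g b - g a\<bar> \<le> (h b - h (b - d n)) - (h (a + d n) - h a)" for n
  proof -
    define y where "y = (\<lambda>j. a + real j * d n)"
    have y_mem: "y j \<in> {a..b}" if "j \<le> 2 * Suc n" for j
    proof -
      have "real j * d n \<le> real (2 * Suc n) * d n"
        using that d_nonneg by (intro mult_right_mono) auto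
      then show ?thesis
        using d_nonneg[of n] d_total[of n] by (simp add: y_def)
    qed
    have step: "\<bar>g (y (j + 2)) - g (y j)\<bar> \<le> h (y (j + 2)) + h (y j) - 2 * h (y (j + 1))"
      if "j + 2 \<le> 2 * Suc n" for j
    proof -
      have "(y (j + 2) + y j) / 2 = y (j + 1)"
        by (simp add: y_def field_simps)
      then show ?thesis
        using bound[OF y_mem y_mem, of "j + 2" j] that by simp
    qed
    have "\<bar>g (y (2 * k + 2)) - g (y 0)\<bar>
        \<le> (h (y (2 * k + 2)) - h (y (2 * k + 1))) - (h (y 1) - h (y 0))" if "k \<le> n" for k
      using that
    proof (induction k)
      case 0
      then show ?case
        using step[of 0] by simp
    next
      case (Suc k)
      \<comment> \<open>Besides the increment over the new cell, the bound at the grid point between the two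
        cells is needed: it says that the first differences of \<open>h\<close> increase across it.\<close>
      show ?case
        using Suc step[of "2 * k + 1"] step[of "2 * k + 2"]
        by (simp add: eval_nat_numeral)
    qed
    from this[of n] have "\<bar>g (y (2 * n + 2)) - g (y 0)\<bar>
        \<le> (h (y (2 * n + 2)) - h (y (2 * n + 1))) - (h (y 1) - h (y 0))"
      by simp
    moreover have "y (2 * n + 2) = b" "y (2 * n + 1) = b - d n" "y 1 = a + d n" "y 0 = a"
      using d_total[of n] by (simp_all add: y_def algebra_simps)
    ultimately show ?thesis
      by simp
  qed
  have "(\<lambda>n. (b - a) / 2 * inverse (real (Suc n))) \<longlonglongrightarrow> (b - a) / 2 * 0"
    by (intro tendsto_intros LIMSEQ_inverse_real_of_nat)
  then have d_lim: "d \<longlonglongrightarrow> 0"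
    by (simp add: d_def field_simps)
  have d_le: "d n \<le> b - a" for n
    using ab by (simp add: d_def divide_le_eq mult_le_cancel_left1 flip: mult.commute)
  have "(\<lambda>n. h (b - d n)) \<longlonglongrightarrow> h b" "(\<lambda>n. h (a + d n)) \<longlonglongrightarrow> h a"
    using ab d_nonneg d_le d_lim
    by (intro continuous_on_tendsto_compose[OF cont] always_eventually allI;
        auto intro!: tendsto_eq_intros simp: algebra_simps)+
  then have "(\<lambda>n. (h b - h (b - d n)) - (h (a + d n) - h a)) \<longlonglongrightarrow> (h b - h b) - (h a - h a)"
    by (intro tendsto_intros)
  then have "\<bar>g b - g a\<bar> \<le> (h b - h b) - (h a - h a)"
    using grid_bound by (intro LIMSEQ_le_const) auto
  then show ?thesis
    by simp
qed

text \<open>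
  Adding the instances for \<open>(s, t)\<close> and \<open>(t, s)\<close> would only bound the even part of \<open>f\<close>; taken
  separately, they bound the odd part by second differences of the even part, so the odd part is
  constant and vanishes. Evenness on an interval follows by letting \<open>r\<close> vary.
\<close>
lemma reflected_midpoint_imp_eq_at_ends:
  fixes f :: "real \<Rightarrow> real"
  assumes r: "0 \<le> r" and cont: "continuous_on {-r..r} f"
    and ineq: "\<And>s t. s \<in> {-r..r} \<Longrightarrow> t \<in> {-r..r} \<Longrightarrow>
      f ((s + t) / 2) + f (- ((s + t) / 2)) \<le> f s + f (- t)"
  shows "f (- r) = f r"
proof -
  \<comment> \<open>Twice the even and the odd part of \<open>f\<close>.\<close>
  define h where "h = (\<lambda>s. f s + f (- s))"
  define g where "g = (\<lambda>s. f s - f (- s))"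
  have "continuous_on {-r..r} (\<lambda>s. f (- s))"
    by (intro continuous_on_compose2[OF cont] continuous_intros) auto
  then have "continuous_on {-r..r} h"
    unfolding h_def using cont by (intro continuous_intros)
  moreover have "\<bar>g s - g t\<bar> \<le> h s + h t - 2 * h ((s + t) / 2)"
    if "s \<in> {-r..r}" "t \<in> {-r..r}" for s t
  proof -
    have "h ((s + t) / 2) \<le> f s + f (- t)" "h ((s + t) / 2) \<le> f t + f (- s)"
      using ineq[OF that] ineq[OF that(2,1)] by (simp_all add: h_def add.commute[of t s])
    then show ?thesis
      by (simp add: h_def g_def)
  qed
  ultimately have "g (- r) = g r"
    using r by (intro second_difference_bound_imp_constant[of "- r" r h g]) auto
  then show ?thesis
    by (simp add: g_def)
qed

theorem lemma10:
  fixes a :: "real \<times> real \<Rightarrow> real"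
  assumes "continuous_on ({-1..1} \<times> {0..}) a"
    and "\<And>s t v. s \<in> {-1..1} \<Longrightarrow> t \<in> {-1..1} \<Longrightarrow> v \<in> {0..} \<Longrightarrow>
           a (s, v) + a (t, v) \<ge> a ((s - t) / 2, v) + a ((t - s) / 2, v)"
  shows "\<forall>v\<in>{0..}. (\<forall>s\<in>{-1..1}. a (- s, v) = a (s, v)) \<and>
           convex_on {-1..1} (\<lambda>s. a (s, v))"
proof
  fix v :: real
  assume v: "v \<in> {0..}"
  define f where "f = (\<lambda>s. a (s, v))"
  have cont: "continuous_on {-1..1} f"
    unfolding f_def using v
    by (intro continuous_on_compose2[OF assms(1)] continuous_intros) auto
  have ineq: "f ((s + t) / 2) + f (- ((s + t) / 2)) \<le> f s + f (- t)"
    if "s \<in> {-1..1}" "t \<in> {-1..1}" for s t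
  proof -
    have "- t \<in> {-1..1}"
      using that by auto
    moreover have "(s - (- t)) / 2 = (s + t) / 2" "(- t - s) / 2 = - ((s + t) / 2)"
      by (simp_all add: field_simps)
    ultimately show ?thesis
      using assms(2)[OF that(1) _ v, of "- t"] by (simp only: f_def)
  qed
  have even: "f (- s) = f s" if s: "s \<in> {-1..1}" for s
  proof -
    have sub: "{-\<bar>s\<bar>..\<bar>s\<bar>} \<subseteq> {-1..1}"
      using s by auto
    have "f (- \<bar>s\<bar>) = f \<bar>s\<bar>"
      using reflected_midpoint_imp_eq_at_ends[OF _ continuous_on_subset[OF cont sub]] ineq sub
      by (meson abs_ge_zero subsetD)
    then show ?thesis
      by (cases "0 \<le> s") auto
  qed
  have "convex_on {-1..1} f"
  proof (rule continuous_midpoint_convex_imp_convex_on[OF _ cont])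
    fix x y :: real
    assume xy: "x \<in> {-1..1}" "y \<in> {-1..1}"
    then have m: "(x + y) / 2 \<in> {-1..1}"
      by auto
    have "2 * f ((x + y) / 2) \<le> f x + f y"
      using ineq[OF xy] even[OF m] even[OF xy(2)] by linarith
    moreover have "midpoint x y = (x + y) / 2"
      by (simp add: midpoint_def)
    ultimately show "2 * f (midpoint x y) \<le> f x + f y"
      by (simp only:)
  qed simp
  then show "(\<forall>s\<in>{-1..1}. a (- s, v) = a (s, v)) \<and> convex_on {-1..1} (\<lambda>s. a (s, v))"
    using even by (simp add: f_def)
qed

end
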